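(* Let $\hat\rho(a,x)$ be an (estimated) policy ratio and $\hat w(y)$ an (estimated) outcome weight, both regarded as fixed functions, and define $$\tilde\theta_{\mathrm{IPW}}:=\frac1n\sum_{i=1}^n\hat\rho(a_i,x_i)\,y_i,\qquad \tilde\theta_{\mathrm{MR}}:=\frac1n\sum_{i=1}^n\hat w(y_i)\,y_i .$$ Let $\tilde w(Y):=\mathbb E_{\pi^b}[\hat\rho(A,X)\mid Y]$ and define the approximation error $\epsilon:=\hat w(Y)-\tilde w(Y)$. Then $$\mathrm{Bias}(\tilde\theta_{\mathrm{MR}})-\mathrm{Bias}(\tilde\theta_{\mathrm{IPW}})=\mathbb E_{\pi^b}[\epsilon\,Y].$$ Moreover, $$\mathrm{Var}_{\pi^b}[\tilde\theta_{\mathrm{IPW}}]-\mathrm{Var}_{\pi^b}[\tilde\theta_{\mathrm{MR}}]=\frac1n\Big(\mathbb E_{\pi^b}\big[\mathrm{Var}_{\pi^b}[\hat\rho(A,X)\,Y\mid Y]\big]-\mathrm{Var}_{\pi^b}[\epsilon\,Y]-2\,\mathrm{Cov}(\tilde w(Y)\,Y,\ \epsilon\,Y)\Big),$$ where $\mathbb E_{\pi^b}\big[\mathrm{Var}_{\pi^b}[\hat\rho(A,X)\,Y\mid Y]\big]\ge 0$.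
   Context: Contextual bandit setting. $X\in\mathcal X$ is a context, $A\in\mathcal A$ an action, $Y\in\mathcal Y\subseteq\mathbb R$ a scalar outcome; for a policy $\pi(a\mid x)$ the joint density of $(X,A,Y)$ is $p_\pi(x,a,y)=p(y\mid x,a)\,\pi(a\mid x)\,p(x)$ (with respect to fixed reference measures). $\mathbb E_\pi$, $\mathrm{Var}_\pi$ denote expectation and variance under $p_\pi$. There is a behaviour policy $\pi^b$ and a target policy $\pi^*$. The evaluation data $(x_i,a_i,y_i)_{i=1}^n$ are i.i.d. from $p_{\pi^b}$; $\hat\rho$ and $\hat w$ are obtained from a separate training dataset and so are fixed with respect to the evaluation data ($\hat\rho(a,x)$ is an estimate of $\pi^*(a\mid x)/\pi^b(a\mid x)$, $\hat w(y)$ an estimate of $\mathbb E_{\pi^b}[\hat\rho(A,X)\mid Y=y]$). The bias of an estimator $\theta$ is $\mathrm{Bias}(\theta)=\mathbb E_{\pi^b}[\theta]-\mathbb E_{\pi^*}[Y]$. Covariances are under $p_{\pi^b}$. All expectations, variances and covariances appearing are implicitly assumed to exist and be finite. *)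

theory Defs
  imports "HOL-Probability.Probability"
begin

text \<open>
  A contextual bandit is given by sigma-finite reference measures \<open>MX\<close>, \<open>MA\<close>, \<open>MY\<close> for contexts,
  actions and outcomes, a context density \<open>px x\<close> for \<open>p(x)\<close> and a conditional outcome density
  \<open>py y x a\<close> for \<open>p(y | x, a)\<close>. The reference measure for outcomes lives on a set \<open>YS\<close> of reals
  with its Borel sigma-algebra, which covers discrete and continuous outcomes alike.
\<close>

definition contextual_bandit ::
  "'x measure \<Rightarrow> 'a measure \<Rightarrow> real measure \<Rightarrow> real set \<Rightarrow> ('x \<Rightarrow> real) \<Rightarrow>
    (real \<Rightarrow> 'x \<Rightarrow> 'a \<Rightarrow> real) \<Rightarrow> bool" where
  "contextual_bandit MX MA MY YS px py \<longleftrightarrow>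
     sigma_finite_measure MX \<and> sigma_finite_measure MA \<and> sigma_finite_measure MY \<and>
     sets MY = sets (restrict_space borel YS) \<and>
     px \<in> borel_measurable MX \<and>
     (\<forall>x\<in>space MX. 0 \<le> px x) \<and>
     (\<integral>\<^sup>+x. ennreal (px x) \<partial>MX) = 1 \<and>
     (\<lambda>(x, a, y). py y x a) \<in> borel_measurable (MX \<Otimes>\<^sub>M MA \<Otimes>\<^sub>M MY) \<and>
     (\<forall>x\<in>space MX. \<forall>a\<in>space MA. \<forall>y\<in>space MY. 0 \<le> py y x a) \<and>
     (\<forall>x\<in>space MX. \<forall>a\<in>space MA. (\<integral>\<^sup>+y. ennreal (py y x a) \<partial>MY) = 1)"

text \<open>\<open>pol a x\<close> stands for the conditional density \<open>\<pi>(a | x)\<close>.\<close>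

definition policy :: "'x measure \<Rightarrow> 'a measure \<Rightarrow> ('a \<Rightarrow> 'x \<Rightarrow> real) \<Rightarrow> bool" where
  "policy MX MA pol \<longleftrightarrow>
     (\<lambda>(x, a). pol a x) \<in> borel_measurable (MX \<Otimes>\<^sub>M MA) \<and>
     (\<forall>x\<in>space MX. \<forall>a\<in>space MA. 0 \<le> pol a x) \<and>
     (\<forall>x\<in>space MX. (\<integral>\<^sup>+a. ennreal (pol a x) \<partial>MA) = 1)"

definition joint_law ::
  "'x measure \<Rightarrow> 'a measure \<Rightarrow> real measure \<Rightarrow> ('x \<Rightarrow> real) \<Rightarrow> (real \<Rightarrow> 'x \<Rightarrow> 'a \<Rightarrow> real) \<Rightarrow>
    ('a \<Rightarrow> 'x \<Rightarrow> real) \<Rightarrow> ('x \<times> 'a \<times> real) measure" where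
  "joint_law MX MA MY px py pol =
     density (MX \<Otimes>\<^sub>M MA \<Otimes>\<^sub>M MY) (\<lambda>(x, a, y). ennreal (py y x a * pol a x * px x))"

definition outcome :: "'x \<times> 'a \<times> real \<Rightarrow> real" where
  "outcome = (\<lambda>(x, a, y). y)"

definition policy_ratio :: "('a \<Rightarrow> 'x \<Rightarrow> real) \<Rightarrow> 'x \<times> 'a \<times> real \<Rightarrow> real" where
  "policy_ratio rho = (\<lambda>(x, a, y). rho a x)"

definition covar :: "'w measure \<Rightarrow> ('w \<Rightarrow> real) \<Rightarrow> ('w \<Rightarrow> real) \<Rightarrow> real" where
  "covar M U V = prob_space.expectation M (\<lambda>w. (U w - prob_space.expectation M U) * (V w - prob_space.expectation M V))"

text \<open>
  Conditioning on a real random variable \<open>V\<close> is conditioning on the sigma-algebra it generates, so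
  \<open>E[Z | V]\<close> and \<open>Var[Z | V]\<close> are random variables on \<open>M\<close>, determined up to null sets.
\<close>

definition cond_expect :: "'w measure \<Rightarrow> ('w \<Rightarrow> real) \<Rightarrow> ('w \<Rightarrow> real) \<Rightarrow> 'w \<Rightarrow> real" where
  "cond_expect M Z V = real_cond_exp M (vimage_algebra (space M) V borel) Z"

definition cond_var :: "'w measure \<Rightarrow> ('w \<Rightarrow> real) \<Rightarrow> ('w \<Rightarrow> real) \<Rightarrow> 'w \<Rightarrow> real" where
  "cond_var M Z V = cond_expect M (\<lambda>w. (Z w - cond_expect M Z V w)\<^sup>2) V"

text \<open>The data points are \<open>D 0, \<dots>, D (n - 1)\<close>; values \<open>D i\<close> with \<open>i \<ge> n\<close> are irrelevant.\<close>

definition iid_sample :: "'w measure \<Rightarrow> nat \<Rightarrow> (nat \<Rightarrow> 'w \<Rightarrow> 'z) \<Rightarrow> 'z measure \<Rightarrow> bool" where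
  "iid_sample P n D M \<longleftrightarrow>
     prob_space P \<and>
     prob_space.indep_vars P (\<lambda>_. M) D {..<n} \<and>
     (\<forall>i<n. distr P M (D i) = M)"

definition theta_IPW ::
  "nat \<Rightarrow> ('a \<Rightarrow> 'x \<Rightarrow> real) \<Rightarrow> (nat \<Rightarrow> 'w \<Rightarrow> 'x \<times> 'a \<times> real) \<Rightarrow> 'w \<Rightarrow> real" where
  "theta_IPW n rho D \<omega> = 1 / real n * (\<Sum>i<n. policy_ratio rho (D i \<omega>) * outcome (D i \<omega>))"

definition theta_MR ::
  "nat \<Rightarrow> (real \<Rightarrow> real) \<Rightarrow> (nat \<Rightarrow> 'w \<Rightarrow> 'x \<times> 'a \<times> real) \<Rightarrow> 'w \<Rightarrow> real" where
  "theta_MR n wh D \<omega> = 1 / real n * (\<Sum>i<n. wh (outcome (D i \<omega>)) * outcome (D i \<omega>))"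

text \<open>\<open>P\<close> is the law governing the data (behaviour policy), \<open>Q\<close> the joint law of one triple
  under the target policy.\<close>

definition bias :: "'w measure \<Rightarrow> ('x \<times> 'a \<times> real) measure \<Rightarrow> ('w \<Rightarrow> real) \<Rightarrow> real" where
  "bias P Q \<theta> = prob_space.expectation P \<theta> - prob_space.expectation Q outcome"

end

theory Submission
  imports Defs
begin

text \<open>
  Write \<open>S = \<rho>(A, X) Y\<close>, \<open>U = w(Y) Y\<close> for the estimated weight \<open>w\<close>, and \<open>W = E[S | Y]\<close>. Since
  \<open>Y\<close> is measurable with respect to its own sigma-algebra, pulling it out gives
  \<open>W = E[\<rho>(A, X) | Y] Y\<close>, hence \<open>\<epsilon> Y = U - W\<close>. The bias identity is then \<open>E S = E W\<close>. For the
  variances, the law of total variance splits \<open>Var S\<close> into \<open>E[Var[S | Y]] + Var W\<close>, while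
  \<open>Var U = Var W + Var (U - W) + 2 Cov(W, U - W)\<close>; independence of the data contributes
  the factor \<open>1/n\<close>.
\<close>

section \<open>Square-integrable functions\<close>

lemma integrable_mult_square:
  fixes f g :: "'a \<Rightarrow> real"
  assumes [measurable]: "f \<in> borel_measurable M" "g \<in> borel_measurable M"
    and sq: "integrable M (\<lambda>x. (f x)\<^sup>2)" "integrable M (\<lambda>x. (g x)\<^sup>2)"
  shows "integrable M (\<lambda>x. f x * g x)"
proof (rule Bochner_Integration.integrable_bound[OF Bochner_Integration.integrable_add[OF sq]])
  have "\<bar>a * b\<bar> \<le> a\<^sup>2 + b\<^sup>2" for a b :: real
    using sum_squares_bound[of a b] sum_squares_bound[of a "- b"] by (auto simp: abs_le_iff)
  then show "AE x in M. norm (f x * g x) \<le> norm ((f x)\<^sup>2 + (g x)\<^sup>2)"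
    by auto
qed measurable

lemma integrable_square_add:
  fixes f g :: "'a \<Rightarrow> real"
  assumes "f \<in> borel_measurable M" "g \<in> borel_measurable M"
    and "integrable M (\<lambda>x. (f x)\<^sup>2)" "integrable M (\<lambda>x. (g x)\<^sup>2)"
  shows "integrable M (\<lambda>x. (f x + g x)\<^sup>2)"
  using integrable_mult_square[OF assms] assms(3,4) by (simp add: power2_sum mult.assoc)

lemma integrable_square_diff:
  fixes f g :: "'a \<Rightarrow> real"
  assumes "f \<in> borel_measurable M" "g \<in> borel_measurable M"
    and "integrable M (\<lambda>x. (f x)\<^sup>2)" "integrable M (\<lambda>x. (g x)\<^sup>2)"
  shows "integrable M (\<lambda>x. (f x - g x)\<^sup>2)"
  using integrable_mult_square[OF assms] assms(3,4) by (simp add: power2_diff mult.assoc)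

section \<open>Variances, covariances and conditional expectations on a probability space\<close>

context prob_space
begin

lemma covar_eq:
  assumes [simp]: "integrable M U" "integrable M V" "integrable M (\<lambda>x. U x * V x)"
  shows "covar M U V = expectation (\<lambda>x. U x * V x) - expectation U * expectation V"
  by (simp add: covar_def left_diff_distrib right_diff_distrib prob_space)

lemma variance_add:
  fixes U V :: "'a \<Rightarrow> real"
  assumes meas[measurable]: "U \<in> borel_measurable M" "V \<in> borel_measurable M"
    and sq: "integrable M (\<lambda>x. (U x)\<^sup>2)" "integrable M (\<lambda>x. (V x)\<^sup>2)"
  shows "variance (\<lambda>x. U x + V x) = variance U + variance V + 2 * covar M U V"
proof -
  \<comment> \<open>The measure is finite, so a finite second moment forces a finite mean.\<close>
  have int[simp]: "integrable M U" "integrable M V"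
    using sq by (auto intro: square_integrable_imp_integrable)
  have prod[simp]: "integrable M (\<lambda>x. U x * V x)"
    by (rule integrable_mult_square[OF meas sq])
  have "expectation (\<lambda>x. (U x + V x)\<^sup>2)
      = expectation (\<lambda>x. (U x)\<^sup>2) + expectation (\<lambda>x. (V x)\<^sup>2) + 2 * expectation (\<lambda>x. U x * V x)"
    using sq by (simp add: power2_sum mult.assoc)
  moreover have "variance (\<lambda>x. U x + V x)
      = expectation (\<lambda>x. (U x + V x)\<^sup>2) - (expectation U + expectation V)\<^sup>2"
    using variance_eq[OF _ integrable_square_add[OF meas sq]] by simp
  ultimately show ?thesis
    by (simp add: variance_eq[OF int(1) sq(1)] variance_eq[OF int(2) sq(2)] covar_eq power2_sum)
qed

lemma covar_indep:
  fixes U V :: "'a \<Rightarrow> real"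
  assumes "indep_var borel U borel V" "integrable M U" "integrable M V"
  shows "covar M U V = 0"
  using assms by (simp add: covar_eq indep_var_integrable indep_var_lebesgue_integral)

text \<open>Cross covariances vanish by independence. Square integrability of the sum is part of the
  conclusion because the induction step applies \<open>variance_add\<close> to the partial sum,
  which asks for it.\<close>

lemma variance_sum_indep:
  fixes X :: "'i \<Rightarrow> 'a \<Rightarrow> real"
  assumes "finite I" "indep_vars (\<lambda>_. borel) X I"
    and "\<And>i. i \<in> I \<Longrightarrow> integrable M (\<lambda>x. (X i x)\<^sup>2)"
  shows "integrable M (\<lambda>x. (\<Sum>i\<in>I. X i x)\<^sup>2) \<and>
    variance (\<lambda>x. \<Sum>i\<in>I. X i x) = (\<Sum>i\<in>I. variance (X i))"
  using assms
proof (induction I)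
  case empty
  then show ?case by simp
next
  case (insert i I)
  let ?S = "\<lambda>x. \<Sum>i\<in>I. X i x"
  have meas: "X j \<in> borel_measurable M" if "j \<in> insert i I" for j
    using insert.prems(1) that by (auto simp: indep_vars_def)
  then have measS: "?S \<in> borel_measurable M"
    by simp
  have IH: "integrable M (\<lambda>x. (?S x)\<^sup>2)" "variance ?S = (\<Sum>i\<in>I. variance (X i))"
    using insert.IH insert.prems indep_vars_subset[OF insert.prems(1), of I] by auto
  have sq: "integrable M (\<lambda>x. (X i x)\<^sup>2)"
    using insert.prems by simp
  \<comment> \<open>As \<open>i\<close> lies outside \<open>I\<close>, \<open>X i\<close> is
    independent of the sum over \<open>I\<close>.\<close>
  have "covar M (X i) ?S = 0"
    using insert.hyps insert.prems(1) meas measS sq IH(1)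
    by (intro covar_indep indep_vars_sum) (auto intro: square_integrable_imp_integrable)
  then show ?case
    using insert.hyps variance_add[OF meas measS sq IH(1)]
      integrable_square_add[OF meas measS sq IH(1)] IH(2)
    by simp
qed

text \<open>Conditional Jensen inequality for squaring: the square of E[X | F] is at most
  E[X^2 | F], which is integrable.\<close>

lemma integrable_real_cond_exp_square:
  assumes "subalgebra M F" and meas: "X \<in> borel_measurable M" and sq: "integrable M (\<lambda>x. (X x)\<^sup>2)"
  shows "integrable M (\<lambda>x. (real_cond_exp M F X x)\<^sup>2)"
proof -
  interpret finite_measure_subalgebra M F
    using assms(1) by unfold_locales
  show ?thesis
    using sq convex_power2
    by (intro integrable_convex_cond_exp[where I = UNIV] square_integrable_imp_integrable[OF meas])
      auto
qed

text \<open>E[X | F] is the orthogonal projection of \<open>X\<close> in L2, so the mean squared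
  residual is E[X^2] minus E[E[X | F]^2]. Adding the variance of E[X | F], which has the same mean
  as \<open>X\<close>, leaves the variance of \<open>X\<close>.\<close>

lemma law_of_total_variance:
  assumes sub: "subalgebra M F"
    and meas[measurable]: "X \<in> borel_measurable M" and sq: "integrable M (\<lambda>x. (X x)\<^sup>2)"
  shows "variance X = expectation (real_cond_exp M F (\<lambda>x. (X x - real_cond_exp M F X x)\<^sup>2))
    + variance (real_cond_exp M F X)"
proof -
  interpret finite_measure_subalgebra M F
    using sub by unfold_locales
  let ?C = "real_cond_exp M F X"
  note sqC = integrable_real_cond_exp_square[OF sub meas sq]
  have intX: "integrable M X"
    using sq by (auto intro: square_integrable_imp_integrable)
  have CX: "integrable M (\<lambda>x. ?C x * X x)"
    by (rule integrable_mult_square[OF _ meas sqC sq]) simp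
  \<comment> \<open>\<open>?C\<close> is measurable for \<open>F\<close>, so \<open>X\<close> may be
    replaced by its conditional expectation \<open>?C\<close> under the integral.\<close>
  have orth: "expectation (\<lambda>x. ?C x * X x) = expectation (\<lambda>x. (?C x)\<^sup>2)"
    using real_cond_exp_intg(2)[OF CX _ meas] by (simp add: power2_eq_square)
  have "expectation (real_cond_exp M F (\<lambda>x. (X x - ?C x)\<^sup>2)) = expectation (\<lambda>x. (X x - ?C x)\<^sup>2)"
    by (intro real_cond_exp_int(2) integrable_square_diff[OF meas _ sq sqC]) simp
  also have "\<dots> = expectation (\<lambda>x. (X x)\<^sup>2 + (?C x)\<^sup>2 - 2 * (?C x * X x))"
    by (simp add: power2_diff algebra_simps)
  also have "\<dots> = expectation (\<lambda>x. (X x)\<^sup>2) - expectation (\<lambda>x. (?C x)\<^sup>2)"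
    using sq sqC CX orth by simp
  finally show ?thesis
    using variance_eq[OF intX sq] variance_eq[OF real_cond_exp_int(1)[OF intX] sqC]
      real_cond_exp_int(2)[OF intX]
    by simp
qed

end

section \<open>Sample means of i.i.d. data\<close>

context
  fixes P :: "'w measure" and n :: nat and D :: "nat \<Rightarrow> 'w \<Rightarrow> 'z" and M :: "'z measure"
  assumes data: "iid_sample P n D M" and n: "n \<ge> 1"
begin

interpretation P: prob_space P
  using data by (simp add: iid_sample_def)

lemma iid_sample_measurable: "i < n \<Longrightarrow> D i \<in> measurable P M"
  using data by (simp add: iid_sample_def P.indep_vars_def)

lemma iid_sample_distr: "i < n \<Longrightarrow> distr P M (D i) = M"
  using data by (simp add: iid_sample_def)

text \<open>\<open>M\<close> is the law of \<open>D 0\<close>, a genuine data point since n \<ge> 1,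
  and so inherits total mass 1 from \<open>P\<close>.\<close>

lemma iid_sample_prob_space: "prob_space M"
  using P.prob_space_distr[OF iid_sample_measurable[of 0]] iid_sample_distr[of 0] n by simp

context
  fixes f :: "'z \<Rightarrow> real"
  assumes f: "f \<in> borel_measurable M"
begin

text \<open>Change of variables along \<open>D i\<close>. The free \<open>g\<close> serves as
  identity, square and centred square, which covers means, second moments and variances.\<close>

lemma iid_sample_integral:
  fixes g :: "real \<Rightarrow> real"
  assumes "g \<in> borel_measurable borel" "i < n"
  shows "(\<integral>\<omega>. g (f (D i \<omega>)) \<partial>P) = (\<integral>z. g (f z) \<partial>M)"
    and "integrable P (\<lambda>\<omega>. g (f (D i \<omega>))) \<longleftrightarrow> integrable M (\<lambda>z. g (f z))"
  using measurable_compose[OF f assms(1)] iid_sample_distr[OF assms(2)]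
    integral_distr[OF iid_sample_measurable[OF assms(2)], of "\<lambda>z. g (f z)"]
    integrable_distr_eq[OF iid_sample_measurable[OF assms(2)], of "\<lambda>z. g (f z)"]
  by simp_all

lemma expectation_sample_mean:
  assumes "integrable M f"
  shows "(\<integral>\<omega>. 1 / real n * (\<Sum>i<n. f (D i \<omega>)) \<partial>P) = (\<integral>z. f z \<partial>M)"
  using n assms iid_sample_integral[of "\<lambda>x. x"] by simp

lemma variance_sample_mean:
  assumes sq: "integrable M (\<lambda>z. (f z)\<^sup>2)"
  shows "prob_space.variance P (\<lambda>\<omega>. 1 / real n * (\<Sum>i<n. f (D i \<omega>)))
    = 1 / real n * prob_space.variance M f"
proof -
  let ?S = "\<lambda>\<omega>. \<Sum>i<n. f (D i \<omega>)"
  have indep: "P.indep_vars (\<lambda>_. borel) (\<lambda>i \<omega>. f (D i \<omega>)) {..<n}"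
    by (rule P.indep_vars_compose2[of "\<lambda>_. M" D]) (use data f in \<open>auto simp: iid_sample_def\<close>)
  have sqP: "integrable P (\<lambda>\<omega>. (f (D i \<omega>))\<^sup>2)" if "i < n" for i
    using iid_sample_integral(2)[of "\<lambda>x. x\<^sup>2", OF _ that] sq by simp
  have S: "P.variance ?S = (\<Sum>i<n. P.variance (\<lambda>\<omega>. f (D i \<omega>)))"
    using P.variance_sum_indep[OF _ indep] sqP by simp
  have var: "P.variance (\<lambda>\<omega>. f (D i \<omega>)) = (\<integral>z. (f z - (\<integral>z. f z \<partial>M))\<^sup>2 \<partial>M)" if "i < n" for i
    using iid_sample_integral(1)[of "\<lambda>x. (x - (\<integral>z. f z \<partial>M))\<^sup>2", OF _ that]
      iid_sample_integral(1)[of "\<lambda>x. x", OF _ that] by simp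
  \<comment> \<open>Scaling contributes 1/n^2 and the sum n equal variances, hence the factor
    1/n.\<close>
  have "P.variance (\<lambda>\<omega>. 1 / real n * ?S \<omega>) = (1 / real n)\<^sup>2 * P.variance ?S"
    by (simp add: power_divide flip: diff_divide_distrib)
  also have "\<dots> = 1 / real n * (\<integral>z. (f z - (\<integral>z. f z \<partial>M))\<^sup>2 \<partial>M)"
    using n unfolding S by (simp add: var power2_eq_square[of "real n"] power_divide)
  finally show ?thesis .
qed

end

end

text \<open>Conditional expectation preserves nonnegativity almost everywhere. Measurability of
  \<open>Z\<close> suffices, since the integral of a non-integrable function is 0 by
  convention.\<close>

lemma cond_var_expectation_nonneg:
  assumes "prob_space M" "subalgebra M (vimage_algebra (space M) V borel)"
    and "Z \<in> borel_measurable M"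
  shows "0 \<le> (\<integral>x. cond_var M Z V x \<partial>M)"
proof -
  interpret prob_space M by fact
  interpret finite_measure_subalgebra M "vimage_algebra (space M) V borel"
    using assms(2) by unfold_locales
  show ?thesis
    unfolding cond_var_def cond_expect_def
    using assms(3) by (intro integral_nonneg_AE real_cond_exp_pos) auto
qed

section \<open>Comparison of the two estimators\<close>

theorem proposition3p7:
  fixes MX :: "'x measure" and MA :: "'a measure" and MY :: "real measure" and YS :: "real set"
    and px :: "'x \<Rightarrow> real" and py :: "real \<Rightarrow> 'x \<Rightarrow> 'a \<Rightarrow> real"
    and pi_b pi_t :: "'a \<Rightarrow> 'x \<Rightarrow> real"
    and Pb Pt :: "('x \<times> 'a \<times> real) measure"
    and P :: "'w measure" and n :: nat and D :: "nat \<Rightarrow> 'w \<Rightarrow> 'x \<times> 'a \<times> real"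
    and rho :: "'a \<Rightarrow> 'x \<Rightarrow> real" and wh :: "real \<Rightarrow> real"
    and wt eps :: "'x \<times> 'a \<times> real \<Rightarrow> real"
  assumes bandit: "contextual_bandit MX MA MY YS px py"
    and behaviour: "policy MX MA pi_b"
    and target: "policy MX MA pi_t"
    and Pb: "Pb = joint_law MX MA MY px py pi_b"
    and Pt: "Pt = joint_law MX MA MY px py pi_t"
    and n: "n \<ge> 1"
    and data: "iid_sample P n D Pb"
    and rho: "(\<lambda>(x, a). rho a x) \<in> borel_measurable (MX \<Otimes>\<^sub>M MA)"
    and wh: "wh \<in> borel_measurable MY"
    and wt: "wt = cond_expect Pb (policy_ratio rho) outcome"
    and eps: "eps = (\<lambda>z. wh (outcome z) - wt z)"
    and int_target: "integrable Pt outcome"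
    and int_ratio: "integrable Pb (policy_ratio rho)"
    and int_IPW: "integrable Pb (\<lambda>z. policy_ratio rho z * outcome z)"
    and int_MR: "integrable Pb (\<lambda>z. wh (outcome z) * outcome z)"
  shows "bias P Pt (theta_MR n wh D) - bias P Pt (theta_IPW n rho D)
           = prob_space.expectation Pb (\<lambda>z. eps z * outcome z) \<and>
         (integrable Pb (\<lambda>z. (policy_ratio rho z * outcome z)\<^sup>2) \<and>
          integrable Pb (\<lambda>z. (wh (outcome z) * outcome z)\<^sup>2) \<longrightarrow>
            prob_space.variance P (theta_IPW n rho D) - prob_space.variance P (theta_MR n wh D)
              = 1 / real n *
                (prob_space.expectation Pb (cond_var Pb (\<lambda>z. policy_ratio rho z * outcome z) outcome)
                 - prob_space.variance Pb (\<lambda>z. eps z * outcome z)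
                 - 2 * covar Pb (\<lambda>z. wt z * outcome z) (\<lambda>z. eps z * outcome z)) \<and>
            prob_space.expectation Pb (cond_var Pb (\<lambda>z. policy_ratio rho z * outcome z) outcome) \<ge> 0)"
proof -
  interpret P: prob_space P
    using data by (simp add: iid_sample_def)
  interpret Pb: prob_space Pb
    by (rule iid_sample_prob_space[OF data n])
  have sets_Pb: "sets Pb = sets (MX \<Otimes>\<^sub>M MA \<Otimes>\<^sub>M MY)"
    unfolding Pb joint_law_def by simp
  have sets_MY: "sets MY = sets (restrict_space borel YS)"
    using bandit by (simp add: contextual_bandit_def)
  have outcome_MY: "outcome \<in> measurable Pb MY"
    unfolding outcome_def measurable_cong_sets[OF sets_Pb refl] by measurable
  have MY_borel: "measurable Pb MY = measurable Pb (restrict_space borel YS)"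
    by (rule measurable_cong_sets[OF refl sets_MY])
  have outcome_meas[measurable]: "outcome \<in> borel_measurable Pb"
    using outcome_MY unfolding MY_borel by (simp add: measurable_restrict_space2_iff)
  have ratio_meas[measurable]: "policy_ratio rho \<in> borel_measurable Pb"
    using int_ratio by auto

  \<comment> \<open>The sigma-algebra behind \<open>cond_expect\<close> and \<open>cond_var\<close>
    when conditioning on the outcome.\<close>
  define F where "F = vimage_algebra (space Pb) outcome borel"
  have sub: "subalgebra Pb F"
    unfolding subalgebra_def F_def by (simp add: sets_image_in_sets)
  interpret F: finite_measure_subalgebra Pb F
    using sub by unfold_locales
  have outcome_F[measurable]: "outcome \<in> borel_measurable F"
    unfolding F_def by (rule measurable_vimage_algebra1) simp
  \<comment> \<open>\<open>wh\<close> is measurable on \<open>MY\<close> only, so the composition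
    has to pass through \<open>MY\<close>; that the outcome stays in \<open>YS\<close> comes from
    \<open>outcome_MY\<close>.\<close>
  have "outcome \<in> measurable F (restrict_space borel YS)"
    using outcome_F outcome_MY unfolding MY_borel
    by (simp add: measurable_restrict_space2_iff F_def)
  then have "outcome \<in> measurable F MY"
    using measurable_cong_sets[OF refl sets_MY] by blast
  then have wh_F[measurable]: "(\<lambda>z. wh (outcome z)) \<in> borel_measurable F"
    using wh by (rule measurable_compose)
  have wh_Pb[measurable]: "(\<lambda>z. wh (outcome z)) \<in> borel_measurable Pb"
    by (rule measurable_from_subalg[OF sub wh_F])

  define S where "S = (\<lambda>z :: 'x \<times> 'a \<times> real. policy_ratio rho z * outcome z)"
  define U where "U = (\<lambda>z :: 'x \<times> 'a \<times> real. wh (outcome z) * outcome z)"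
  define W where "W = (\<lambda>z :: 'x \<times> 'a \<times> real. wt z * outcome z)"
  have wt': "wt = real_cond_exp Pb F (policy_ratio rho)"
    unfolding wt cond_expect_def F_def ..
  have S_meas[measurable]: "S \<in> borel_measurable Pb" and U_meas[measurable]: "U \<in> borel_measurable Pb"
    and [measurable]: "W \<in> borel_measurable Pb"
    unfolding S_def U_def W_def wt' by measurable
  have eps_U: "eps z * outcome z = U z - W z" for z
    by (simp add: eps U_def W_def left_diff_distrib)
  \<comment> \<open>The results on pulling out a factor expect the \<open>F\<close>-measurable one
    first.\<close>
  have YR: "integrable Pb (\<lambda>z. outcome z * policy_ratio rho z)"
    using int_IPW by (simp add: mult.commute)
  have W: "integrable Pb W" "Pb.expectation W = Pb.expectation S"
    using F.real_cond_exp_intg[OF YR outcome_F ratio_meas]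
    by (simp_all add: W_def S_def wt' mult.commute)
  \<comment> \<open>Conditional expectations are fixed only up to null sets, so \<open>W\<close> is
    a version of E[S | Y] and later transfers between the two are almost everywhere.\<close>
  have W_cond: "AE z in Pb. real_cond_exp Pb F S z = W z"
    using F.real_cond_exp_mult[OF outcome_F ratio_meas YR]
    by (simp add: S_def W_def wt' mult.commute)
  have theta: "theta_IPW n rho D = (\<lambda>\<omega>. 1 / real n * (\<Sum>i<n. S (D i \<omega>)))"
    "theta_MR n wh D = (\<lambda>\<omega>. 1 / real n * (\<Sum>i<n. U (D i \<omega>)))"
    by (auto simp: theta_IPW_def theta_MR_def S_def U_def)
  have int: "integrable Pb S" "integrable Pb U"
    using int_IPW int_MR by (simp_all add: S_def U_def)

  \<comment> \<open>The target mean cancels, leaving E[U] - E[S] = E[U] - E[W].\<close>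
  have bias: "bias P Pt (theta_MR n wh D) - bias P Pt (theta_IPW n rho D)
      = Pb.expectation (\<lambda>z. eps z * outcome z)"
    unfolding bias_def theta eps_U
    using expectation_sample_mean[OF data n _ int(1)] expectation_sample_mean[OF data n _ int(2)]
      int W by simp
  have nonneg: "0 \<le> Pb.expectation (cond_var Pb S outcome)"
    using sub unfolding F_def by (intro cond_var_expectation_nonneg Pb.prob_space_axioms) auto

  have "P.variance (theta_IPW n rho D) - P.variance (theta_MR n wh D)
      = 1 / real n * (Pb.expectation (cond_var Pb S outcome)
          - Pb.variance (\<lambda>z. U z - W z) - 2 * covar Pb W (\<lambda>z. U z - W z))"
    if sq: "integrable Pb (\<lambda>z. (S z)\<^sup>2)" "integrable Pb (\<lambda>z. (U z)\<^sup>2)"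
  proof -
    have C: "integrable Pb (\<lambda>z. (real_cond_exp Pb F S z)\<^sup>2)"
      by (rule Pb.integrable_real_cond_exp_square[OF sub _ sq(1)]) measurable
    have sqW: "integrable Pb (\<lambda>z. (W z)\<^sup>2)"
      by (rule integrable_cong_AE_imp[OF C]) (use W_cond in auto)
    \<comment> \<open>The means are matched first because they are the centres inside the two
      variances.\<close>
    have "Pb.expectation (real_cond_exp Pb F S) = Pb.expectation W"
      using W_cond by (intro integral_cong_AE) auto
    then have "Pb.variance (real_cond_exp Pb F S) = Pb.variance W"
      using W_cond by (intro integral_cong_AE) auto
    then have varS: "Pb.variance S = Pb.expectation (cond_var Pb S outcome) + Pb.variance W"
      using Pb.law_of_total_variance[OF sub _ sq(1)]
      unfolding cond_var_def cond_expect_def F_def by simp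
    \<comment> \<open>Decomposition U = W + (U - W), where U - W is the error term \<epsilon>
      Y.\<close>
    have varU: "Pb.variance U = Pb.variance W + Pb.variance (\<lambda>z. U z - W z)
        + 2 * covar Pb W (\<lambda>z. U z - W z)"
      using Pb.variance_add[OF _ _ sqW integrable_square_diff[OF _ _ sq(2) sqW]] by simp
    \<comment> \<open>The variance of \<open>W\<close> occurs in both \<open>varS\<close> and
      \<open>varU\<close> and cancels.\<close>
    show ?thesis
      unfolding theta variance_sample_mean[OF data n S_meas sq(1)]
        variance_sample_mean[OF data n U_meas sq(2)] varS varU
      by (simp add: right_diff_distrib distrib_left)
  qed
  with bias nonneg show ?thesis
    unfolding eps_U S_def U_def W_def by simp
qed

end
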